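(* Let $E$ be a finite or infinite dimensional complex Hilbert space with open unit ball $B_E$, let $x,y\in B_E$ be not both zero, and let $z\in\mathbb{C}$. If $$|z|\le \frac{1+\max\{\|x\|,\|y\|\}}{2\max\{\|x\|,\|y\|\}},$$ then $zx,zy\in B_E$ and, whenever $z\neq 0$ and $x\neq y$, $$\frac{\rho_E(zx,zy)}{|z|\,\rho_E(x,y)}\le 2 .$$
   Context: For a complex Hilbert space $E$ with open unit ball $B_E$, the pseudohyperbolic distance $\rho_E(x,y)\in[0,1)$ of $x,y\in B_E$ is given by $$\rho_E(x,y)^2=1-\frac{(1-\|x\|^2)(1-\|y\|^2)}{|1-\langle x,y\rangle|^2}.$$ (It coincides with $\sup\{\rho(f(x),f(y)) : f:B_E\to\mathbb{C} \text{ bounded holomorphic}, \|f\|_\infty\le 1\}$, where $\rho(a,b)=\left|\frac{a-b}{1-\bar a b}\right|$ on the open unit disk.) *)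

theory Defs
  imports "HOL-Analysis.Analysis"
begin

text \<open>
  Complex Hilbert spaces of arbitrary (finite or infinite) dimension. Completeness and the
  underlying real normed structure come from \<^class>\<open>banach\<close>; the complex scalar multiplication
  extends the real one, and the norm is the one induced by the inner product, which is
  linear in its first argument.
\<close>

class complex_hilbert = banach +
  fixes scaleC :: "complex \<Rightarrow> 'a \<Rightarrow> 'a" (infixr "*\<^sub>C" 75)
    and cinner :: "'a \<Rightarrow> 'a \<Rightarrow> complex"
  assumes scaleC_add_right: "a *\<^sub>C (x + y) = a *\<^sub>C x + a *\<^sub>C y"
    and scaleC_add_left: "(a + b) *\<^sub>C x = a *\<^sub>C x + b *\<^sub>C x"
    and scaleC_scaleC: "a *\<^sub>C (b *\<^sub>C x) = (a * b) *\<^sub>C x"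
    and scaleC_one: "1 *\<^sub>C x = x"
    and scaleR_scaleC: "r *\<^sub>R x = complex_of_real r *\<^sub>C x"
    and cinner_commute: "cinner x y = cnj (cinner y x)"
    and cinner_add_left: "cinner (x + y) w = cinner x w + cinner y w"
    and cinner_scaleC_left: "cinner (a *\<^sub>C x) y = a * cinner x y"
    and cinner_ge_zero: "0 \<le> Re (cinner x x)"
    and cinner_eq_zero_iff: "cinner x x = 0 \<longleftrightarrow> x = 0"
    and norm_eq_sqrt_cinner: "norm x = sqrt (Re (cinner x x))"

interpretation complex_hilbert: vector_space "scaleC :: complex \<Rightarrow> 'a \<Rightarrow> 'a::complex_hilbert"
  by unfold_locales (simp_all add: scaleC_add_right scaleC_add_left scaleC_scaleC scaleC_one)

instantiation complex :: complex_hilbert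
begin

definition scaleC_complex :: "complex \<Rightarrow> complex \<Rightarrow> complex" where
  "scaleC_complex a x = a * x"

definition cinner_complex :: "complex \<Rightarrow> complex \<Rightarrow> complex" where
  "cinner_complex x y = x * cnj y"

instance
  by standard
    (simp_all add: scaleC_complex_def cinner_complex_def algebra_simps scaleR_conv_of_real
      cmod_def power2_eq_square)

end

definition pseudohyp :: "'a::complex_hilbert \<Rightarrow> 'a \<Rightarrow> real" where
  "pseudohyp x y =
     sqrt (1 - (1 - (norm x)\<^sup>2) * (1 - (norm y)\<^sup>2) / (cmod (1 - cinner x y))\<^sup>2)"

lemma cinner_self: "cinner x x = complex_of_real ((norm x)\<^sup>2)"
  for x :: "'a::complex_hilbert"
proof -
  have "Im (cinner x x) = 0"
    using arg_cong[OF cinner_commute[of x x], of Im] by simp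
  then show ?thesis
    by (simp add: norm_eq_sqrt_cinner cinner_ge_zero complex_eq_iff)
qed

lemma cinner_add_right: "cinner w (x + y) = cinner w x + cinner w y"
  for x :: "'a::complex_hilbert"
  by (metis cinner_add_left cinner_commute complex_cnj_add)

lemma cinner_scaleC_right: "cinner x (a *\<^sub>C y) = cnj a * cinner x y"
  for x :: "'a::complex_hilbert"
  by (metis cinner_scaleC_left cinner_commute complex_cnj_mult)

lemma norm_scaleC: "norm (a *\<^sub>C x) = cmod a * norm x"
  for x :: "'a::complex_hilbert"
proof -
  have "complex_of_real ((norm (a *\<^sub>C x))\<^sup>2) = complex_of_real ((cmod a * norm x)\<^sup>2)"
    unfolding cinner_self[symmetric] cinner_scaleC_left cinner_scaleC_right
    using complex_norm_square[of a] by (simp add: cinner_self power_mult_distrib)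
  then have "(norm (a *\<^sub>C x))\<^sup>2 = (cmod a * norm x)\<^sup>2"
    using of_real_eq_iff by blast
  then show ?thesis
    by (simp add: power2_eq_iff_nonneg)
qed

lemma cinner_Cauchy_Schwarz: "cmod (cinner x y) \<le> norm x * norm y"
  for x y :: "'a::complex_hilbert"
proof (cases "y = 0")
  case True
  then show ?thesis
    using cinner_scaleC_right[of x 0 0] complex_hilbert.scale_zero_left by simp
next
  case False
  define c where "c = cinner x y"
  define n where "n = (norm y)\<^sup>2"
  define a where "a = - (c / complex_of_real n)"
  have n: "n > 0" using False by (simp add: n_def)
  have "complex_of_real ((norm (x + a *\<^sub>C y))\<^sup>2)
      = complex_of_real ((norm x)\<^sup>2) + cnj a * c + a * cnj c + a * cnj a * complex_of_real n"
    unfolding cinner_self[symmetric] n_def c_def cinner_commute[of x y, symmetric]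
    by (simp add: cinner_add_left cinner_add_right cinner_scaleC_left cinner_scaleC_right
        algebra_simps cinner_commute[of y x])
  also have "\<dots> = complex_of_real ((norm x)\<^sup>2) - c * cnj c / complex_of_real n"
    using n by (simp add: a_def field_simps)
  also have "\<dots> = complex_of_real ((norm x)\<^sup>2 - (cmod c)\<^sup>2 / n)"
    using complex_norm_square[of c] by simp
  finally have "(norm (x + a *\<^sub>C y))\<^sup>2 = (norm x)\<^sup>2 - (cmod c)\<^sup>2 / n"
    using of_real_eq_iff by blast
  then have "(cmod c)\<^sup>2 / n \<le> (norm x)\<^sup>2"
    by (metis diff_ge_0_iff_ge zero_le_power2)
  then have "(cmod c)\<^sup>2 \<le> (norm x * norm y)\<^sup>2"
    using n by (simp add: field_simps n_def power_mult_distrib)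
  then show ?thesis
    unfolding c_def by (rule power2_le_imp_le) simp
qed

text \<open>On the unit ball the denominator is nonzero and the radicand lies in \<open>[0,1)\<close>.\<close>

lemma
  fixes x y :: "'a::complex_hilbert"
  assumes "x \<in> ball 0 1" "y \<in> ball 0 1"
  shows cinner_neq_one: "cinner x y \<noteq> 1"
    and pseudohyp_square: "(pseudohyp x y)\<^sup>2 =
      1 - (1 - (norm x)\<^sup>2) * (1 - (norm y)\<^sup>2) / (cmod (1 - cinner x y))\<^sup>2"
    and pseudohyp_nonneg: "0 \<le> pseudohyp x y"
    and pseudohyp_less_one: "pseudohyp x y < 1"
proof -
  let ?r = "norm x" and ?s = "norm y" and ?d = "cmod (1 - cinner x y)"
  have r: "0 \<le> ?r" "?r < 1" and s: "0 \<le> ?s" "?s < 1" using assms by auto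
  have "?r * ?s \<le> ?r * 1" using r s by (intro mult_left_mono) auto
  then have rs: "?r * ?s < 1" using r by linarith
  have d: "1 - ?r * ?s \<le> ?d"
    using cinner_Cauchy_Schwarz[of x y] norm_triangle_ineq2[of 1 "cinner x y"] by simp
  then have d0: "?d > 0" using rs by linarith
  then show ne: "cinner x y \<noteq> 1" by auto
  have "(1 - ?r\<^sup>2) * (1 - ?s\<^sup>2) \<le> (1 - ?r * ?s)\<^sup>2"
    using zero_le_power2[of "?r - ?s"] by (simp add: power2_eq_square algebra_simps)
  also have "\<dots> \<le> ?d\<^sup>2" using d rs by (intro power_mono) auto
  finally have le: "(1 - ?r\<^sup>2) * (1 - ?s\<^sup>2) / ?d\<^sup>2 \<le> 1"
    using d0 by (simp add: divide_simps)
  have "?r\<^sup>2 < 1" "?s\<^sup>2 < 1" using r s by (simp_all add: power_less_one_iff)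
  then have gt: "0 < (1 - ?r\<^sup>2) * (1 - ?s\<^sup>2) / ?d\<^sup>2" using d0 by simp
  show "(pseudohyp x y)\<^sup>2 = 1 - (1 - ?r\<^sup>2) * (1 - ?s\<^sup>2) / ?d\<^sup>2" "0 \<le> pseudohyp x y"
    "pseudohyp x y < 1"
    unfolding pseudohyp_def using le gt by simp_all
qed

end

theory Submission imports Defs begin

text \<open>
  Put \<open>w = \<langle>x,y\<rangle>\<close>, \<open>D = \<parallel>x - y\<parallel>\<^sup>2\<close>, \<open>G = \<parallel>x\<parallel>\<^sup>2 \<parallel>y\<parallel>\<^sup>2 - \<bar>w\<bar>\<^sup>2\<close> and \<open>s = \<bar>z\<bar>\<^sup>2\<close>. Clearing denominators turns
  the definition of the pseudohyperbolic distance into \<open>\<rho>(x,y)\<^sup>2 = (D - G) / \<bar>1 - w\<bar>\<^sup>2\<close>, and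
  multiplication by \<open>z\<close> replaces \<open>D\<close>, \<open>G\<close>, \<open>w\<close> by \<open>s D\<close>, \<open>s\<^sup>2 G\<close>, \<open>s w\<close>. So the claim is
  \<open>(D - s G) \<bar>1 - w\<bar>\<^sup>2 \<le> 4 (D - G) \<bar>1 - s w\<bar>\<^sup>2\<close>.
  The Gram determinant \<open>G\<close> is nonnegative by the Cauchy-Schwarz inequality.

  If \<open>s \<ge> 1\<close>, then \<open>D - s G \<le> D - G\<close>, and only \<open>\<bar>1 - w\<bar> \<le> 2 \<bar>1 - s w\<bar>\<close> is left. By the triangle inequality
  this follows from \<open>(2 s - 1) \<bar>w\<bar> \<le> 1\<close>. With \<open>m = max \<parallel>x\<parallel> \<parallel>y\<parallel>\<close>, \<open>\<bar>w\<bar> \<le> m\<^sup>2\<close>, and the bound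
  on \<open>\<bar>z\<bar>\<close> says \<open>2 \<bar>z\<bar> m \<le> 1 + m\<close>, so \<open>(2 s - 1) \<bar>w\<bar> \<le> (1 + m)\<^sup>2 / 2 - m\<^sup>2 = 1 - (1 - m)\<^sup>2 / 2\<close>.

  If \<open>s \<le> 1\<close>, then \<open>D - s G\<close> may exceed \<open>D - G\<close>, so \<open>G\<close> has to be controlled by \<open>D\<close>. For fixed \<open>w\<close> the
  quotient \<open>G / D\<close> increases with \<open>\<parallel>x\<parallel>\<close> and \<open>\<parallel>y\<parallel>\<close>, so it is at most its value
  \<open>(1 - \<bar>w\<bar>\<^sup>2) / (2 - 2 Re w)\<close> at unit vectors (lemma \<open>gram_le_dist\<close>). For unit vectors \<open>D - G = \<bar>1 - w\<bar>\<^sup>2\<close>,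
  a factor \<open>\<bar>1 - w\<bar>\<^sup>2\<close> cancels, and a sharpened triangle inequality finishes the proof
  (lemma \<open>unit_sphere_bound\<close>).
\<close>

lemma cmod_one_minus_square: "(cmod (1 - w))\<^sup>2 = 1 - 2 * Re w + (cmod w)\<^sup>2"
  by (simp add: cmod_power2) (simp add: power2_eq_square algebra_simps)

lemma cmod_one_minus_le:
  fixes s :: real and w :: complex
  shows "cmod (1 - w) \<le> cmod (1 - s * w) + \<bar>1 - s\<bar> * cmod w"
proof -
  have "1 - w = (1 - s * w) - complex_of_real (1 - s) * w" by (simp add: algebra_simps)
  then have "cmod (1 - w) \<le> cmod (1 - s * w) + cmod (complex_of_real (1 - s) * w)"
    by (simp only: norm_triangle_ineq4)
  then show ?thesis by (simp only: norm_mult norm_of_real)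
qed

lemma pseudohyp_square_gram:
  fixes x y :: "'a::complex_hilbert"
  assumes "x \<in> ball 0 1" "y \<in> ball 0 1"
  shows "(pseudohyp x y)\<^sup>2 =
    ((norm x)\<^sup>2 + (norm y)\<^sup>2 - 2 * Re (cinner x y)
      - ((norm x)\<^sup>2 * (norm y)\<^sup>2 - (cmod (cinner x y))\<^sup>2)) / (cmod (1 - cinner x y))\<^sup>2"
proof -
  have "(cmod (1 - cinner x y))\<^sup>2 \<noteq> 0" using cinner_neq_one[OF assms] by simp
  then have "(pseudohyp x y)\<^sup>2 = ((cmod (1 - cinner x y))\<^sup>2
      - (1 - (norm x)\<^sup>2) * (1 - (norm y)\<^sup>2)) / (cmod (1 - cinner x y))\<^sup>2"
    by (simp add: pseudohyp_square[OF assms] diff_divide_distrib)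
  then show ?thesis by (simp add: cmod_one_minus_square algebra_simps)
qed

text \<open>
  The comparison with unit vectors raises \<open>a = \<parallel>x\<parallel>\<^sup>2\<close> and \<open>b = \<parallel>y\<parallel>\<^sup>2\<close> to \<open>1\<close> one after the
  other. The first step rests on \<open>\<bar>b - w\<bar>\<^sup>2 \<ge> 0\<close>, the second on \<open>\<bar>1 - w\<bar>\<^sup>2 \<ge> 0\<close>.
\<close>

lemma gram_le_dist:
  fixes a b :: real and w :: complex
  assumes a: "0 \<le> a" "a < 1" and b: "0 \<le> b" "b < 1" and w: "(cmod w)\<^sup>2 \<le> a * b"
  shows "(a * b - (cmod w)\<^sup>2) * (2 - 2 * Re w) \<le> (1 - (cmod w)\<^sup>2) * (a + b - 2 * Re w)"
proof -
  define u q where "u = Re w" and "q = (cmod w)\<^sup>2"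
  have uq: "u\<^sup>2 \<le> q" by (simp add: u_def q_def cmod_power2)
  have wab: "q \<le> a * b" using w by (simp add: q_def)
  have dist_ge: "0 \<le> a + b - 2 * u"
  proof -
    have "(2 * u)\<^sup>2 \<le> 4 * (a * b)" using uq wab by (simp add: power_mult_distrib)
    also have "\<dots> \<le> (a + b)\<^sup>2"
      using zero_le_power2[of "a - b"] by (simp add: power2_eq_square algebra_simps)
    finally have "2 * u \<le> a + b"
      by (rule power2_le_imp_le) (use a b in simp)
    then show ?thesis by simp
  qed
  have E: "0 < 1 + b - 2 * u"
    using dist_ge a by linarith
  have F: "0 \<le> 2 - 2 * u" using dist_ge a b by linarith
  have step1: "(a * b - q) * (1 + b - 2 * u) \<le> (b - q) * (a + b - 2 * u)"
  proof -
    have "0 \<le> (b - u)\<^sup>2 + (q - u\<^sup>2)" using uq by simp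
    then have "0 \<le> (1 - a) * ((b - u)\<^sup>2 + (q - u\<^sup>2))" using a by simp
    also have "\<dots> = (b - q) * (a + b - 2 * u) - (a * b - q) * (1 + b - 2 * u)"
      by (simp add: power2_eq_square algebra_simps)
    finally show ?thesis by simp
  qed
  have step2: "(b - q) * (2 - 2 * u) \<le> (1 - q) * (1 + b - 2 * u)"
  proof -
    have "0 \<le> (1 - b) * ((1 - u)\<^sup>2 + (q - u\<^sup>2))" using uq b by simp
    also have "\<dots> = (1 - q) * (1 + b - 2 * u) - (b - q) * (2 - 2 * u)"
      by (simp add: power2_eq_square algebra_simps)
    finally show ?thesis by simp
  qed
  have "(1 + b - 2 * u) * ((a * b - q) * (2 - 2 * u))
      = ((a * b - q) * (1 + b - 2 * u)) * (2 - 2 * u)" by simp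
  also have "\<dots> \<le> ((b - q) * (a + b - 2 * u)) * (2 - 2 * u)"
    using step1 F by (rule mult_right_mono)
  also have "\<dots> = ((b - q) * (2 - 2 * u)) * (a + b - 2 * u)" by simp
  also have "\<dots> \<le> ((1 - q) * (1 + b - 2 * u)) * (a + b - 2 * u)"
    using step2 dist_ge by (rule mult_right_mono)
  also have "\<dots> = (1 + b - 2 * u) * ((1 - q) * (a + b - 2 * u))" by simp
  finally show ?thesis using E by (simp add: u_def q_def)
qed

text \<open>
  The main inequality for two unit vectors, after cancellation of \<open>\<bar>1 - w\<bar>\<^sup>2\<close>. Squaring
  \<open>\<bar>1 - w\<bar> \<le> \<bar>1 - s w\<bar> + (1 - s) \<bar>w\<bar>\<close> costs a factor \<open>2\<close>, and the slack in
  \<open>(1 - s) \<bar>w\<bar> \<le> 1 - s \<bar>w\<bar> \<le> \<bar>1 - s w\<bar>\<close> absorbs the additional term \<open>(1 - s) (1 - \<bar>w\<bar>\<^sup>2)\<close>.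
\<close>

lemma unit_sphere_bound:
  fixes s :: real and w :: complex
  assumes s: "0 \<le> s" "s \<le> 1" and w: "cmod w \<le> 1"
  shows "(cmod (1 - w))\<^sup>2 + (1 - s) * (1 - (cmod w)\<^sup>2) \<le> 4 * (cmod (1 - s * w))\<^sup>2"
proof -
  define r B where "r = cmod w" and "B = cmod (1 - s * w)"
  have r: "0 \<le> r" "r \<le> 1" using w by (simp_all add: r_def)
  have sr: "s * r \<le> 1" using s r by (simp add: mult_le_one)
  have B: "1 - s * r \<le> B"
    using norm_triangle_ineq2[of 1 "s * w"] s by (simp add: B_def r_def norm_mult)
  have B2: "(1 - s * r)\<^sup>2 \<le> B\<^sup>2" using B sr by (intro power_mono) auto
  have "cmod (1 - w) \<le> B + (1 - s) * r"
    using cmod_one_minus_le[of w s] s by (simp add: B_def r_def)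
  then have "(cmod (1 - w))\<^sup>2 \<le> (B + (1 - s) * r)\<^sup>2" by (intro power_mono) auto
  also have "\<dots> \<le> 2 * B\<^sup>2 + 2 * ((1 - s) * r)\<^sup>2"
    using zero_le_power2[of "B - (1 - s) * r"] by (simp add: power2_eq_square algebra_simps)
  finally have parallelogram: "(cmod (1 - w))\<^sup>2 \<le> 2 * B\<^sup>2 + 2 * ((1 - s) * r)\<^sup>2" .
  have "0 \<le> (1 - r) * (2 * ((1 - s) * r) + (1 + s) * (1 - r))"
    using s r by (intro mult_nonneg_nonneg add_nonneg_nonneg) auto
  also have "\<dots> = 2 * (1 - s * r)\<^sup>2 - 2 * ((1 - s) * r)\<^sup>2 - (1 - s) * (1 - r\<^sup>2)"
    by (simp add: power2_eq_square algebra_simps)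
  finally have slack: "2 * ((1 - s) * r)\<^sup>2 + (1 - s) * (1 - r\<^sup>2) \<le> 2 * (1 - s * r)\<^sup>2"
    by simp
  from parallelogram slack B2 show ?thesis by (simp add: r_def B_def)
qed

lemma gram_bound_contraction:
  fixes a b s :: real and w :: complex
  assumes a: "0 \<le> a" "a < 1" and b: "0 \<le> b" "b < 1" and w: "(cmod w)\<^sup>2 \<le> a * b"
    and s: "0 \<le> s" "s \<le> 1"
  shows "(a + b - 2 * Re w - s * (a * b - (cmod w)\<^sup>2)) * (cmod (1 - w))\<^sup>2
    \<le> 4 * (a + b - 2 * Re w - (a * b - (cmod w)\<^sup>2)) * (cmod (1 - s * w))\<^sup>2"
proof -
  define q D G F A B where "q = (cmod w)\<^sup>2" and "D = a + b - 2 * Re w" and "G = a * b - q"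
    and "F = 2 - 2 * Re w" and "A = (cmod (1 - w))\<^sup>2" and "B = (cmod (1 - s * w))\<^sup>2"
  have "a * b < 1" using a b mult_left_le_one_le[of b a] by linarith
  then have q1: "q < 1" using w by (simp add: q_def)
  then have w1: "cmod w < 1" by (simp add: q_def abs_square_less_1)
  then have "Re w < 1" using complex_Re_le_cmod[of w] by linarith
  then have F: "0 < F" by (simp add: F_def)
  have AF: "A = F - (1 - q)" by (simp add: A_def F_def q_def cmod_one_minus_square)
  have A0: "0 \<le> A" by (simp add: A_def)
  have unit: "A + (1 - s) * (1 - q) \<le> 4 * B"
    using unit_sphere_bound[OF s] w1 by (simp add: A_def B_def q_def)
  moreover have "0 \<le> (1 - s) * (1 - q)" using s q1 by simp
  moreover have "s * A \<le> A" using s A0 by (simp add: mult_left_le_one_le)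
  ultimately have BA: "0 \<le> 4 * B - s * A" by linarith
  have GF: "G * F \<le> (1 - q) * D"
    using gram_le_dist[OF a b w] by (simp add: G_def F_def D_def q_def)
  have D0: "0 \<le> D"
  proof -
    have "0 \<le> G * F" using w F by (simp add: G_def q_def)
    then have "0 \<le> (1 - q) * D" using GF by linarith
    then show ?thesis using q1 by (simp add: zero_le_mult_iff)
  qed
  \<comment> \<open>The claim is \<open>G (4 B - s A) \<le> D (4 B - A)\<close>. Multiplication by \<open>F\<close> brings in the bound on \<open>G F\<close>.\<close>
  have "F * (G * (4 * B - s * A)) = (G * F) * (4 * B - s * A)" by simp
  also have "\<dots> \<le> ((1 - q) * D) * (4 * B - s * A)" using GF BA by (rule mult_right_mono)
  also have "\<dots> = F * (D * (4 * B - A)) - (D * A) * (4 * B - (A + (1 - s) * (1 - q)))"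
    unfolding AF by (simp add: algebra_simps)
  also have "\<dots> \<le> F * (D * (4 * B - A))" using D0 A0 unit by simp
  finally have "G * (4 * B - s * A) \<le> D * (4 * B - A)" using F by simp
  then have "(D - s * G) * A \<le> 4 * (D - G) * B" by (simp add: algebra_simps)
  then show ?thesis by (simp add: D_def G_def A_def B_def q_def)
qed

lemma gram_bound_expansion:
  fixes D G s :: real and w :: complex
  assumes "0 \<le> G" "G \<le> D" and s: "1 \<le> s" and w: "(2 * s - 1) * cmod w \<le> 1"
  shows "(D - s * G) * (cmod (1 - w))\<^sup>2 \<le> 4 * (D - G) * (cmod (1 - s * w))\<^sup>2"
proof -
  have "cmod (1 - w) \<le> cmod (1 - s * w) + (s - 1) * cmod w"
    using cmod_one_minus_le[of w s] s by simp
  moreover have "1 - s * cmod w \<le> cmod (1 - s * w)"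
    using norm_triangle_ineq2[of 1 "s * w"] s by (simp add: norm_mult)
  ultimately have "cmod (1 - w) \<le> 2 * cmod (1 - s * w)"
    using w by (simp add: algebra_simps)
  then have A: "(cmod (1 - w))\<^sup>2 \<le> 4 * (cmod (1 - s * w))\<^sup>2"
    using power_mono[of "cmod (1 - w)" _ 2] by (fastforce simp: power_mult_distrib)
  have "G \<le> s * G" using assms by (simp add: mult_le_cancel_right1)
  then have "(D - s * G) * (cmod (1 - w))\<^sup>2 \<le> (D - G) * (cmod (1 - w))\<^sup>2"
    by (intro mult_right_mono) auto
  also have "\<dots> \<le> (D - G) * (4 * (cmod (1 - s * w))\<^sup>2)"
    using A assms by (intro mult_left_mono) auto
  finally show ?thesis by (simp only: mult.assoc mult.left_commute[of 4])
qed

lemma pseudohyp_scaleC_le: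
  fixes x y :: "'a::complex_hilbert"
  assumes x: "x \<in> ball 0 1" and y: "y \<in> ball 0 1"
    and zx: "z *\<^sub>C x \<in> ball 0 1" and zy: "z *\<^sub>C y \<in> ball 0 1"
    and z: "cmod z \<le> 1 \<or> (2 * (cmod z)\<^sup>2 - 1) * cmod (cinner x y) \<le> 1"
  shows "pseudohyp (z *\<^sub>C x) (z *\<^sub>C y) \<le> 2 * cmod z * pseudohyp x y"
proof -
  define a b w s where "a = (norm x)\<^sup>2" and "b = (norm y)\<^sup>2" and "w = cinner x y"
    and "s = (cmod z)\<^sup>2"
  define D G where "D = a + b - 2 * Re w" and "G = a * b - (cmod w)\<^sup>2"
  have a: "0 \<le> a" "a < 1" and b: "0 \<le> b" "b < 1"
    using x y by (simp_all add: a_def b_def power_less_one_iff)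
  have "(cmod w)\<^sup>2 \<le> (norm x * norm y)\<^sup>2"
    unfolding w_def by (intro power_mono cinner_Cauchy_Schwarz) simp
  then have wab: "(cmod w)\<^sup>2 \<le> a * b" by (simp add: a_def b_def power_mult_distrib)
  have A: "0 < (cmod (1 - w))\<^sup>2" using cinner_neq_one[OF x y] by (simp add: w_def)
  have rho: "(pseudohyp x y)\<^sup>2 = (D - G) / (cmod (1 - w))\<^sup>2"
    using pseudohyp_square_gram[OF x y] by (simp add: D_def G_def a_def b_def w_def)
  have zw: "cinner (z *\<^sub>C x) (z *\<^sub>C y) = s * w"
    using complex_norm_square[of z]
    by (simp add: cinner_scaleC_left cinner_scaleC_right s_def w_def mult.assoc)
  have B: "0 < (cmod (1 - s * w))\<^sup>2" using cinner_neq_one[OF zx zy] by (simp add: zw)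
  have s0: "0 \<le> s" by (simp add: s_def)
  have rho_z: "(pseudohyp (z *\<^sub>C x) (z *\<^sub>C y))\<^sup>2 = s * (D - s * G) / (cmod (1 - s * w))\<^sup>2"
    using pseudohyp_square_gram[OF zx zy] s0
    by (simp add: zw norm_scaleC norm_mult power_mult_distrib D_def G_def
        a_def[symmetric] b_def[symmetric] s_def[symmetric] power2_eq_square[of s] algebra_simps)
  have main: "(D - s * G) * (cmod (1 - w))\<^sup>2 \<le> 4 * (D - G) * (cmod (1 - s * w))\<^sup>2"
  proof (cases "s \<le> 1")
    case True
    then show ?thesis
      using gram_bound_contraction[OF a b wab s0] by (simp add: D_def G_def)
  next
    case False
    then have "(2 * s - 1) * cmod w \<le> 1"
      using z by (auto simp: s_def w_def power_le_one_iff)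
    moreover have "0 \<le> G" using wab by (simp add: G_def)
    moreover have "G \<le> D"
      using zero_le_power2[of "pseudohyp x y"] A unfolding rho by (simp add: zero_le_divide_iff)
    ultimately show ?thesis using False by (intro gram_bound_expansion) auto
  qed
  have "(D - s * G) / (cmod (1 - s * w))\<^sup>2 \<le> 4 * ((D - G) / (cmod (1 - w))\<^sup>2)"
    using main A B by (simp add: divide_simps mult_ac)
  then have "s * ((D - s * G) / (cmod (1 - s * w))\<^sup>2) \<le> s * (4 * ((D - G) / (cmod (1 - w))\<^sup>2))"
    using s0 by (rule mult_left_mono)
  then have "(pseudohyp (z *\<^sub>C x) (z *\<^sub>C y))\<^sup>2 \<le> s * (4 * (pseudohyp x y)\<^sup>2)"
    by (simp add: rho rho_z)
  also have "\<dots> = (2 * cmod z * pseudohyp x y)\<^sup>2" by (simp add: s_def power_mult_distrib)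
  finally show ?thesis
    by (rule power2_le_imp_le) (use pseudohyp_nonneg[OF x y] in simp)
qed

theorem theorem2p7:
  fixes x y :: "'a::complex_hilbert" and z :: complex
  assumes "x \<in> ball 0 1" and "y \<in> ball 0 1"
    and "\<not> (x = 0 \<and> y = 0)"
    and "cmod z \<le> (1 + max (norm x) (norm y)) / (2 * max (norm x) (norm y))"
  shows "z *\<^sub>C x \<in> ball 0 1 \<and> z *\<^sub>C y \<in> ball 0 1 \<and>
    (z \<noteq> 0 \<and> x \<noteq> y \<longrightarrow>
       pseudohyp (z *\<^sub>C x) (z *\<^sub>C y) / (cmod z * pseudohyp x y) \<le> 2)"
proof -
  define m t where "m = max (norm x) (norm y)" and "t = cmod z"
  have m: "0 < m" "m < 1" using assms(1-3) by (auto simp: m_def less_max_iff_disj)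
  have nx: "norm x \<le> m" and ny: "norm y \<le> m" by (simp_all add: m_def)
  have t0: "0 \<le> t" by (simp add: t_def)
  have tm: "2 * (t * m) \<le> 1 + m"
    using assms(4) m by (simp add: m_def[symmetric] t_def[symmetric] field_simps)
  then have "t * m < 1" using m by linarith
  then have zx: "z *\<^sub>C x \<in> ball 0 1" and zy: "z *\<^sub>C y \<in> ball 0 1"
    using mult_left_mono[OF nx t0] mult_left_mono[OF ny t0]
    by (simp_all add: norm_scaleC t_def)
  have "(2 * t\<^sup>2 - 1) * cmod (cinner x y) \<le> 1" if "1 < t"
  proof -
    have t1: "0 \<le> 2 * t\<^sup>2 - 1" using one_le_power[of t 2] that by linarith
    have "cmod (cinner x y) \<le> norm x * norm y" by (rule cinner_Cauchy_Schwarz)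
    also have "\<dots> \<le> m * m" using nx ny m by (intro mult_mono) auto
    finally have "(2 * t\<^sup>2 - 1) * cmod (cinner x y) \<le> (2 * t\<^sup>2 - 1) * (m * m)"
      using t1 by (rule mult_left_mono)
    also have "\<dots> = (2 * (t * m))\<^sup>2 / 2 - m\<^sup>2" by (simp add: power2_eq_square algebra_simps)
    also have "\<dots> \<le> (1 + m)\<^sup>2 / 2 - m\<^sup>2"
      using power_mono[OF tm, of 2] t0 m by simp
    also have "\<dots> = 1 - (1 - m)\<^sup>2 / 2" by (simp add: power2_eq_square field_simps)
    also have "\<dots> \<le> 1" by simp
    finally show ?thesis .
  qed
  then have le: "pseudohyp (z *\<^sub>C x) (z *\<^sub>C y) \<le> 2 * (cmod z * pseudohyp x y)"
    using pseudohyp_scaleC_le[OF assms(1,2) zx zy] by (fastforce simp: t_def mult.assoc)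
  have "0 \<le> cmod z * pseudohyp x y" using pseudohyp_nonneg[OF assms(1,2)] by simp
  \<comment> \<open>If the denominator vanishes, the quotient is \<open>0\<close> by convention.\<close>
  then have "cmod z * pseudohyp x y = 0 \<or> 0 < cmod z * pseudohyp x y" by linarith
  then have "pseudohyp (z *\<^sub>C x) (z *\<^sub>C y) / (cmod z * pseudohyp x y) \<le> 2"
  proof
    assume "cmod z * pseudohyp x y = 0"
    then show ?thesis by (simp only: div_by_0)
  next
    assume "0 < cmod z * pseudohyp x y"
    then show ?thesis using le by (simp only: pos_divide_le_eq)
  qed
  then show ?thesis using zx zy by blast
qed

end
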